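(* Let $Q \subset \mathbb{R}^M$ be a measurable set with $|Q|<\infty$, and let $U_n : Q \to \mathbb{R}^D$, $n=1,2,\dots$, be a sequence of measurable functions. (i) The following are equivalent: - $\{U_n\}_{n=1}^\infty$ is weakly (S)-convergent; - for every $b \in C_c(\mathbb{R}^D)$ there is a function $\overline{b(U)}$ such that $$\frac1N \sum_{n=1}^N b(U_n) \to \overline{b(U)} \quad \text{strongly in } L^1(Q) \text{ as } N\to\infty.$$ (ii) The following are equivalent: - $\{U_n\}_{n=1}^\infty$ is strongly (S)-convergent; - for every $b \in C_c(\mathbb{R}^D)$ there is a function $\overline{b(U)}$ such that for every $w \in W$ $$\frac{1}{w_N} \sum_{n=1}^N w\!\left(\frac nN\right) b(U_n) \to \overline{b(U)} \quad \text{strongly in } L^1(Q) \text{ as } N\to\infty$$ (the limit $\overline{b(U)}$ being independent of $w$).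
   Context: $W = \{ w \in C^1[0,1] : w \ge 0,\ \int_0^1 w(z)\,dz = 1\}$, and for $w\in W$, $w_N = \sum_{n=1}^N w(n/N)$ (positive for all large $N$, since $w_N/N \to 1$; only large $N$ matter). Weak (S)-convergence: $\{U_n\}$ is weakly (S)-convergent if for every $b \in C_c(\mathbb{R}^D)$: (a) for every fixed $m$ the limit $\lim_{N\to\infty} \frac1N \sum_{n=1}^N \int_Q b(U_n) b(U_m)\,dy$ exists; and (b) the following limits exist and $$\lim_{N\to\infty} \frac1{N^2}\sum_{n,m=1}^N \int_Q b(U_n)b(U_m)\,dy = \lim_{M\to\infty} \frac1M \sum_{m=1}^M \Big[ \lim_{N\to\infty} \frac1N \sum_{n=1}^N \int_Q b(U_n) b(U_m)\,dy \Big].$$ Strong (S)-convergence: $\{U_n\}$ is strongly (S)-convergent if for every $b\in C_c(\mathbb{R}^D)$ and every $w \in W$: (a') for every fixed $m$ the limit $\lim_{N\to\infty} \frac1{w_N} \sum_{n=1}^N w(\frac nN)\int_Q b(U_n) b(U_m)\,dy$ exists and is independent of $w$; and (b') the following limits exist and $$\lim_{N\to\infty} \frac1{w_N^2}\sum_{n,m=1}^N w(\tfrac nN) w(\tfrac mN)\int_Q b(U_n)b(U_m)\,dy = \lim_{M\to\infty} \frac1{w_M} \sum_{m=1}^M w(\tfrac mM)\Big[ \lim_{N\to\infty} \frac1{w_N} \sum_{n=1}^N w(\tfrac nN)\int_Q b(U_n) b(U_m)\,dy \Big].$$ *)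

theory Defs
  imports "HOL-Analysis.Analysis"
begin

definition Cc :: "(real ^ 'd \<Rightarrow> real) set" where
  "Cc = {b. continuous_on UNIV b \<and> compact (closure {x. b x \<noteq> 0})}"

text \<open>\<open>C1_differentiable_on\<close> takes two-sided derivatives at the endpoints, so the
  one-sided notion of \<open>C\<^sup>1[0,1]\<close> is spelled out here; values of \<open>w\<close> outside \<open>[0,1]\<close> are irrelevant.\<close>

definition W :: "(real \<Rightarrow> real) set" where
  "W = {w. (\<exists>w'. continuous_on {0..1} w' \<and>
               (\<forall>z\<in>{0..1}. (w has_real_derivative w' z) (at z within {0..1}))) \<and>
           (\<forall>z\<in>{0..1}. w z \<ge> 0) \<and> integral {0..1} w = 1}"

text \<open>The number \<open>w\<^sub>N\<close>. It may vanish for finitely many \<open>N\<close>, where division by it yields \<open>0\<close>;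
  this does not affect limits as \<open>N\<close> tends to infinity.\<close>

definition wsum :: "(real \<Rightarrow> real) \<Rightarrow> nat \<Rightarrow> real" where
  "wsum w N = (\<Sum>n=1..N. w (real n / real N))"

definition corr :: "(real ^ 'm) set \<Rightarrow> (real ^ 'd \<Rightarrow> real) \<Rightarrow> (nat \<Rightarrow> real ^ 'm \<Rightarrow> real ^ 'd) \<Rightarrow>
    nat \<Rightarrow> nat \<Rightarrow> real" where
  "corr Q b U n m = (LINT y|lebesgue_on Q. b (U n y) * b (U m y))"

text \<open>Sequences \<open>U\<close> are indexed by \<open>n \<ge> 1\<close>; the value \<open>U 0\<close> is never used.\<close>

definition weakly_S_convergent ::
    "(real ^ 'm) set \<Rightarrow> (nat \<Rightarrow> real ^ 'm \<Rightarrow> real ^ 'd) \<Rightarrow> bool" where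
  "weakly_S_convergent Q U \<longleftrightarrow> (\<forall>b\<in>Cc.
     (\<forall>m\<ge>1. convergent (\<lambda>N. 1 / real N * (\<Sum>n=1..N. corr Q b U n m))) \<and>
     convergent (\<lambda>N. 1 / (real N)\<^sup>2 * (\<Sum>n=1..N. \<Sum>m=1..N. corr Q b U n m)) \<and>
     convergent (\<lambda>M. 1 / real M * (\<Sum>m=1..M. lim (\<lambda>N. 1 / real N * (\<Sum>n=1..N. corr Q b U n m)))) \<and>
     lim (\<lambda>N. 1 / (real N)\<^sup>2 * (\<Sum>n=1..N. \<Sum>m=1..N. corr Q b U n m)) =
     lim (\<lambda>M. 1 / real M * (\<Sum>m=1..M. lim (\<lambda>N. 1 / real N * (\<Sum>n=1..N. corr Q b U n m)))))"

definition strongly_S_convergent ::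
    "(real ^ 'm) set \<Rightarrow> (nat \<Rightarrow> real ^ 'm \<Rightarrow> real ^ 'd) \<Rightarrow> bool" where
  "strongly_S_convergent Q U \<longleftrightarrow> (\<forall>b\<in>Cc.
     (\<forall>m\<ge>1. \<exists>l. \<forall>w\<in>W.
        (\<lambda>N. 1 / wsum w N * (\<Sum>n=1..N. w (real n / real N) * corr Q b U n m)) \<longlonglongrightarrow> l) \<and>
     (\<forall>w\<in>W.
        convergent (\<lambda>N. 1 / (wsum w N)\<^sup>2 *
          (\<Sum>n=1..N. \<Sum>m=1..N. w (real n / real N) * w (real m / real N) * corr Q b U n m)) \<and>
        convergent (\<lambda>M. 1 / wsum w M * (\<Sum>m=1..M. w (real m / real M) *
          lim (\<lambda>N. 1 / wsum w N * (\<Sum>n=1..N. w (real n / real N) * corr Q b U n m)))) \<and>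
        lim (\<lambda>N. 1 / (wsum w N)\<^sup>2 *
          (\<Sum>n=1..N. \<Sum>m=1..N. w (real n / real N) * w (real m / real N) * corr Q b U n m)) =
        lim (\<lambda>M. 1 / wsum w M * (\<Sum>m=1..M. w (real m / real M) *
          lim (\<lambda>N. 1 / wsum w N * (\<Sum>n=1..N. w (real n / real N) * corr Q b U n m))))))"

definition tendsto_L1 ::
    "(real ^ 'm) set \<Rightarrow> (nat \<Rightarrow> real ^ 'm \<Rightarrow> real) \<Rightarrow> (real ^ 'm \<Rightarrow> real) \<Rightarrow> bool" where
  "tendsto_L1 Q F f \<longleftrightarrow>
     (\<forall>N. integrable (lebesgue_on Q) (F N)) \<and> integrable (lebesgue_on Q) f \<and>
     (\<lambda>N. LINT y|lebesgue_on Q. \<bar>F N y - f y\<bar>) \<longlonglongrightarrow> 0"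

end

theory Submission
  imports Defs
begin

text \<open>In \<open>L\<^sup>2(Q)\<close> put \<open>g\<^sub>n = b(U\<^sub>n)\<close>, let \<open>S\<^sub>N\<close> and \<open>T\<^sub>K\<close> be averages of the \<open>g\<^sub>n\<close> for two choices of
  weights, and assume (S)-convergence with \<open>\<langle>S\<^sub>N, g\<^sub>m\<rangle> \<longlongrightarrow> l\<^sub>m\<close> and with limits \<open>L\<close>, \<open>L'\<close> of the squared
  norms. For fixed \<open>K\<close>, the quantity \<open>\<parallel>S\<^sub>N - T\<^sub>K\<parallel>\<^sup>2\<close> tends as \<open>N \<rightarrow> \<infinity>\<close> to \<open>L + \<parallel>T\<^sub>K\<parallel>\<^sup>2\<close> minus twice the
  average of the \<open>l\<^sub>m\<close> that defines \<open>T\<^sub>K\<close>, and this tends to \<open>L - L'\<close> as \<open>K \<rightarrow> \<infinity>\<close>. By symmetry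
  \<open>L = L'\<close>, so the averages are Cauchy with a limit independent of the weights; as they are uniformly
  bounded and \<open>|Q| < \<infinity>\<close>, convergence in \<open>L\<^sup>1\<close> and in \<open>L\<^sup>2\<close> is the same. Of the weights it is only used
  that they are nonnegative with sum at most \<open>1\<close>, which still holds when \<open>w\<^sub>N = 0\<close>.\<close>

section \<open>Bounded functions on a finite measure space\<close>

context finite_measure
begin

lemma integrable_bounded:
  fixes f :: "'a \<Rightarrow> real"
  assumes "f \<in> borel_measurable M" and "\<And>x. \<bar>f x\<bar> \<le> B"
  shows "integrable M f"
  using assms by (intro integrable_const_bound[where B=B]) auto

lemma integrable_bounded_mult:
  fixes f h :: "'a \<Rightarrow> real"
  assumes [measurable]: "f \<in> borel_measurable M" "h \<in> borel_measurable M"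
    and "\<And>x. \<bar>f x\<bar> \<le> B" and "\<And>x. \<bar>h x\<bar> \<le> B"
  shows "integrable M (\<lambda>x. f x * h x)"
proof (rule integrable_bounded)
  show "\<bar>f x * h x\<bar> \<le> B * B" for x
    unfolding abs_mult using assms(3,4)[of x] by (intro mult_mono) auto
qed measurable

text \<open>Cauchy-Schwarz against the constant 1, read off from the nonnegative integral of the
  square of \<open>\<mu> * \<bar>u x\<bar> - I\<close>, which is \<mu> times the deviation of
  \<open>\<bar>u x\<bar>\<close> from its mean.\<close>

lemma L1_le_L2:
  fixes u :: "'a \<Rightarrow> real"
  assumes [measurable]: "u \<in> borel_measurable M" and B: "\<And>x. \<bar>u x\<bar> \<le> B"
  shows "(LINT x|M. \<bar>u x\<bar>) \<le> sqrt (measure M (space M) * (LINT x|M. (u x)\<^sup>2))"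
proof -
  define \<mu> I S where "\<mu> = measure M (space M)" and "I = (LINT x|M. \<bar>u x\<bar>)"
    and "S = (LINT x|M. (u x)\<^sup>2)"
  have int1: "integrable M (\<lambda>x. \<bar>u x\<bar>)"
    using B by (intro integrable_bounded[where B=B]) auto
  have int2: "integrable M (\<lambda>x. (u x)\<^sup>2)"
    unfolding power2_eq_square using B by (intro integrable_bounded_mult[where B=B]) auto
  have "0 \<le> (LINT x|M. (\<mu> * \<bar>u x\<bar> - I)\<^sup>2)"
    by simp
  also have "\<dots> = (LINT x|M. \<mu>\<^sup>2 * (u x)\<^sup>2 - 2 * \<mu> * I * \<bar>u x\<bar> + I\<^sup>2)"
    by (simp add: power2_eq_square algebra_simps)
  also have "\<dots> = \<mu>\<^sup>2 * S - 2 * \<mu> * I * I + \<mu> * I\<^sup>2"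
    using int1 int2 by (simp add: \<mu>_def I_def S_def)
  also have "\<dots> = \<mu> * (\<mu> * S - I\<^sup>2)"
    by (simp add: power2_eq_square algebra_simps)
  finally have "0 \<le> \<mu> * (\<mu> * S - I\<^sup>2)" .
  \<comment> \<open>The factor \<mu> cannot be cancelled when it is 0; in that case this bound
    forces \<open>I = 0\<close>.\<close>
  moreover have "I \<le> \<mu> * B"
  proof -
    have "I \<le> (LINT x|M. B)"
      unfolding I_def using int1 B by (intro integral_mono) auto
    then show ?thesis
      by (simp add: \<mu>_def)
  qed
  moreover have "0 \<le> I" "0 \<le> \<mu>"
    by (simp_all add: I_def \<mu>_def)
  ultimately have "I\<^sup>2 \<le> \<mu> * S"
    by (cases "\<mu> = 0") (auto simp: zero_le_mult_iff)
  then show ?thesis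
    unfolding \<mu>_def I_def S_def by (rule real_le_rsqrt)
qed

text \<open>Completeness of L1: some subsequence \<open>s (r i)\<close> converges almost everywhere,
  and the uniform bound permits dominated convergence, which replaces \<open>s (r i)\<close> by its
  limit in the Cauchy estimate.\<close>

lemma bounded_L1_Cauchy_converges:
  fixes s :: "nat \<Rightarrow> 'a \<Rightarrow> real"
  assumes [measurable]: "\<And>n. s n \<in> borel_measurable M" and B: "\<And>n x. \<bar>s n x\<bar> \<le> B"
    and Cauchy: "\<And>e. e > 0 \<Longrightarrow> \<exists>N. \<forall>i\<ge>N. \<forall>j\<ge>N. (LINT x|M. \<bar>s i x - s j x\<bar>) < e"
  obtains f where "integrable M f" "(\<lambda>n. LINT x|M. \<bar>s n x - f x\<bar>) \<longlonglongrightarrow> 0"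
proof -
  obtain r where r: "strict_mono r" "AE x in M. Cauchy (\<lambda>i. s (r i) x)"
  proof (rule cauchy_L1_AE_cauchy_subseq[of M s])
    show "integrable M (s n)" for n
      using B by (intro integrable_bounded[where B=B]) auto
    show "\<exists>N. \<forall>i\<ge>N. \<forall>j\<ge>N. (LINT x|M. norm (s i x - s j x)) < e" if "e > 0" for e
      using Cauchy[OF that] by simp
  qed (rule that)
  \<comment> \<open>Where the subsequence diverges, \<open>lim\<close> is one fixed unspecified
    value; this concerns a null set and does not harm measurability.\<close>
  define f where "f = (\<lambda>x. lim (\<lambda>i. s (r i) x))"
  have [measurable]: "f \<in> borel_measurable M"
    unfolding f_def by measurable
  have lim: "AE x in M. (\<lambda>i. s (r i) x) \<longlonglongrightarrow> f x"
    using r(2) by eventually_elim (simp add: f_def Cauchy_convergent_iff convergent_LIMSEQ_iff)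
  have "AE x in M. \<bar>f x\<bar> \<le> B"
    using lim by eventually_elim (rule LIMSEQ_le_const2[OF tendsto_rabs], auto simp: B)
  then have int: "integrable M f"
    by (intro integrable_const_bound[where B=B]) auto
  have sub: "(\<lambda>i. LINT x|M. \<bar>s n x - s (r i) x\<bar>) \<longlonglongrightarrow> (LINT x|M. \<bar>s n x - f x\<bar>)" for n
  proof (rule integral_dominated_convergence[where w="\<lambda>_. 2 * B"])
    show "AE x in M. (\<lambda>i. \<bar>s n x - s (r i) x\<bar>) \<longlonglongrightarrow> \<bar>s n x - f x\<bar>"
      using lim by eventually_elim (intro tendsto_intros)
    have "\<bar>s n x - s (r i) x\<bar> \<le> 2 * B" for i x
      using B[of n x] B[of "r i" x] by linarith
    then show "AE x in M. norm \<bar>s n x - s (r i) x\<bar> \<le> 2 * B" for i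
      by simp
  qed auto
  have "(\<lambda>n. LINT x|M. \<bar>s n x - f x\<bar>) \<longlonglongrightarrow> 0"
  proof (rule LIMSEQ_I)
    fix e :: real assume "e > 0"
    then obtain N where N: "\<And>i j. i \<ge> N \<Longrightarrow> j \<ge> N \<Longrightarrow> (LINT x|M. \<bar>s i x - s j x\<bar>) < e / 2"
      using Cauchy[of "e/2"] by auto
    have "(LINT x|M. \<bar>s n x - f x\<bar>) \<le> e / 2" if "n \<ge> N" for n
    proof (rule LIMSEQ_le_const2[OF sub], intro exI[of _ N] allI impI)
      fix i assume "N \<le> i"
      then have "N \<le> r i"
        using seq_suble[OF r(1)] order_trans by blast
      then show "(LINT x|M. \<bar>s n x - s (r i) x\<bar>) \<le> e / 2"
        using N[OF that] by (simp add: less_imp_le)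
    qed
    then have "\<forall>n\<ge>N. norm ((LINT x|M. \<bar>s n x - f x\<bar>) - 0) < e"
      using \<open>e > 0\<close> by fastforce
    then show "\<exists>N. \<forall>n\<ge>N. norm ((LINT x|M. \<bar>s n x - f x\<bar>) - 0) < e" ..
  qed
  with int that show thesis
    by blast
qed

text \<open>The difference of the integrals is at most \<open>B\<close> times the L1 distance of
  \<open>F n\<close> and \<open>f\<close>. The factor \<open>h n\<close> may vary with
  \<open>n\<close>, so that \<open>h = F\<close> can be taken when squared norms are
  treated.\<close>

lemma integral_mult_bounded_tendsto:
  fixes F h :: "nat \<Rightarrow> 'a \<Rightarrow> real"
  assumes [measurable]: "\<And>n. F n \<in> borel_measurable M" "\<And>n. h n \<in> borel_measurable M"
      "f \<in> borel_measurable M"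
    and F: "\<And>n x. \<bar>F n x\<bar> \<le> B" and h: "\<And>n x. \<bar>h n x\<bar> \<le> B" and f: "\<And>x. \<bar>f x\<bar> \<le> B"
    and lim: "(\<lambda>n. LINT x|M. \<bar>F n x - f x\<bar>) \<longlonglongrightarrow> 0"
  shows "(\<lambda>n. (LINT x|M. F n x * h n x) - (LINT x|M. f x * h n x)) \<longlonglongrightarrow> 0"
proof (rule Lim_null_comparison)
  show "(\<lambda>n. B * (LINT x|M. \<bar>F n x - f x\<bar>)) \<longlonglongrightarrow> 0"
    using tendsto_mult_left[OF lim, of B] by simp
  have "norm ((LINT x|M. F n x * h n x) - (LINT x|M. f x * h n x)) \<le> B * (LINT x|M. \<bar>F n x - f x\<bar>)"
    for n
  proof -
    have int: "integrable M (\<lambda>x. F n x * h n x)" "integrable M (\<lambda>x. f x * h n x)"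
      using F h f by (intro integrable_bounded_mult[where B=B]; simp)+
    have int': "integrable M (\<lambda>x. \<bar>F n x - f x\<bar>)"
      using F f by (intro integrable_abs Bochner_Integration.integrable_diff integrable_bounded[where B=B]) auto
    have "norm ((LINT x|M. F n x * h n x) - (LINT x|M. f x * h n x))
        = norm (LINT x|M. F n x * h n x - f x * h n x)"
      using int by simp
    also have "\<dots> \<le> (LINT x|M. norm (F n x * h n x - f x * h n x))"
      by (rule integral_norm_bound)
    also have "\<dots> \<le> (LINT x|M. B * \<bar>F n x - f x\<bar>)"
    proof (rule integral_mono)
      show "integrable M (\<lambda>x. norm (F n x * h n x - f x * h n x))"
        using int by simp
      show "norm (F n x * h n x - f x * h n x) \<le> B * \<bar>F n x - f x\<bar>" for x
        using mult_right_mono[OF h[of n x], of "\<bar>F n x - f x\<bar>"]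
        by (simp add: left_diff_distrib[symmetric] abs_mult mult.commute)
    qed (use int' in simp)
    finally show ?thesis
      by simp
  qed
  then show "\<forall>\<^sub>F n in sequentially. norm ((LINT x|M. F n x * h n x) - (LINT x|M. f x * h n x))
      \<le> B * (LINT x|M. \<bar>F n x - f x\<bar>)"
    by simp
qed

end

section \<open>Weighted averages and their inner products\<close>

definition averaging_weights :: "(nat \<Rightarrow> nat \<Rightarrow> real) \<Rightarrow> bool" where
  "averaging_weights a \<longleftrightarrow> (\<forall>N. (\<forall>n\<in>{1..N}. 0 \<le> a N n) \<and> (\<Sum>n=1..N. a N n) \<le> 1)"

text \<open>Measurability is asked from index 1 on, as nothing is known of \<open>U 0\<close>; the
  bound comes from the test function and so holds at every index.\<close>

locale bounded_sequence = finite_measure M for M :: "'a measure" +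
  fixes g :: "nat \<Rightarrow> 'a \<Rightarrow> real" and B :: real
  assumes measurable_g: "\<And>n. n \<ge> 1 \<Longrightarrow> g n \<in> borel_measurable M"
    and bounded_g: "\<And>n x. \<bar>g n x\<bar> \<le> B"
begin

definition avg :: "(nat \<Rightarrow> nat \<Rightarrow> real) \<Rightarrow> nat \<Rightarrow> 'a \<Rightarrow> real" where
  "avg a N y = (\<Sum>n=1..N. a N n * g n y)"

definition correlation :: "nat \<Rightarrow> nat \<Rightarrow> real" where
  "correlation n m = (LINT y|M. g n y * g m y)"

lemma measurable_avg [measurable]: "avg a N \<in> borel_measurable M"
  unfolding avg_def[abs_def] using measurable_g by (intro borel_measurable_sum borel_measurable_times) auto

lemma abs_avg_le:
  assumes "averaging_weights a"
  shows "\<bar>avg a N y\<bar> \<le> B"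
proof -
  have a: "\<And>n. n \<in> {1..N} \<Longrightarrow> 0 \<le> a N n" "(\<Sum>n=1..N. a N n) \<le> 1"
    using assms unfolding averaging_weights_def by auto
  have "0 \<le> B"
    using bounded_g[of 0 y] by linarith
  have "\<bar>avg a N y\<bar> \<le> (\<Sum>n=1..N. \<bar>a N n * g n y\<bar>)"
    unfolding avg_def by (rule sum_abs)
  also have "\<dots> \<le> (\<Sum>n=1..N. a N n * B)"
    using a(1) bounded_g by (intro sum_mono) (simp add: abs_mult mult_left_mono)
  also have "\<dots> = (\<Sum>n=1..N. a N n) * B"
    by (simp add: sum_distrib_right)
  also have "\<dots> \<le> B"
    using mult_right_mono[OF a(2) \<open>0 \<le> B\<close>] by simp
  finally show ?thesis .
qed

lemma integrable_avg: "averaging_weights a \<Longrightarrow> integrable M (avg a N)"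
  using abs_avg_le by (intro integrable_bounded[where B=B]) auto

lemma integral_avg_mult:
  assumes [measurable]: "h \<in> borel_measurable M" and "\<And>y. \<bar>h y\<bar> \<le> B"
  shows "(LINT y|M. avg a N y * h y) = (\<Sum>n=1..N. a N n * (LINT y|M. g n y * h y))"
proof -
  have int: "integrable M (\<lambda>y. g n y * h y)" if "n \<in> {1..N}" for n
    using that assms measurable_g bounded_g by (intro integrable_bounded_mult[where B=B]) auto
  have "(LINT y|M. avg a N y * h y) = (LINT y|M. (\<Sum>n=1..N. a N n * (g n y * h y)))"
    by (simp add: avg_def sum_distrib_right mult.assoc)
  also have "\<dots> = (\<Sum>n=1..N. (LINT y|M. a N n * (g n y * h y)))"
    using int by (intro Bochner_Integration.integral_sum integrable_mult_right)
  finally show ?thesis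
    by simp
qed

lemma integral_avg_mult_g:
  assumes "m \<ge> 1"
  shows "(LINT y|M. avg a N y * g m y) = (\<Sum>n=1..N. a N n * correlation n m)"
  unfolding correlation_def using assms measurable_g bounded_g by (intro integral_avg_mult) auto

text \<open>Bilinearity and the symmetry of \<open>correlation\<close>. The inner sums run over
  \<open>n\<close>, since for fixed \<open>K\<close> it is these that converge as \<open>N\<close>
  grows.\<close>

lemma integral_avg_mult_avg:
  assumes "averaging_weights a'"
  shows "(LINT y|M. avg a N y * avg a' K y)
    = (\<Sum>m=1..K. a' K m * (\<Sum>n=1..N. a N n * correlation n m))"
proof -
  have "(LINT y|M. avg a N y * avg a' K y) = (\<Sum>n=1..N. a N n * (LINT y|M. avg a' K y * g n y))"
    using assms by (subst integral_avg_mult) (auto simp: abs_avg_le mult.commute)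
  also have "\<dots> = (\<Sum>n=1..N. a N n * (\<Sum>m=1..K. a' K m * correlation m n))"
    by (intro sum.cong) (auto simp: integral_avg_mult_g)
  also have "\<dots> = (\<Sum>n=1..N. \<Sum>m=1..K. a' K m * (a N n * correlation n m))"
    by (simp add: sum_distrib_left correlation_def mult.left_commute mult.commute)
  also have "\<dots> = (\<Sum>m=1..K. \<Sum>n=1..N. a' K m * (a N n * correlation n m))"
    by (rule sum.swap)
  finally show ?thesis
    by (simp add: sum_distrib_left)
qed

lemma integral_avg_square:
  assumes "averaging_weights a"
  shows "(LINT y|M. avg a N y * avg a N y) = (\<Sum>n=1..N. \<Sum>m=1..N. a N n * a N m * correlation n m)"
  unfolding integral_avg_mult_avg[OF assms]
  by (subst sum.swap) (simp add: sum_distrib_left mult.assoc mult.left_commute)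

section \<open>Distances between averages and their common limit\<close>

definition L2_dist_sq where
  "L2_dist_sq a N a' K = (LINT y|M. (avg a N y - avg a' K y)\<^sup>2)"

lemma L1_le_L2_dist:
  assumes "averaging_weights a" "averaging_weights a'"
  shows "(LINT y|M. \<bar>avg a N y - avg a' K y\<bar>) \<le> sqrt (measure M (space M) * L2_dist_sq a N a' K)"
  unfolding L2_dist_sq_def
proof (rule L1_le_L2)
  show "\<bar>avg a N y - avg a' K y\<bar> \<le> 2 * B" for y
    using abs_avg_le[OF assms(1), of N y] abs_avg_le[OF assms(2), of K y] by linarith
qed measurable

lemma L2_dist_sq_expand:
  assumes "averaging_weights a" "averaging_weights a'"
  shows "L2_dist_sq a N a' K = (LINT y|M. avg a N y * avg a N y)
    + (LINT y|M. avg a' K y * avg a' K y) - 2 * (LINT y|M. avg a N y * avg a' K y)"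
proof -
  have "integrable M (\<lambda>y. avg a N y * avg a N y)" "integrable M (\<lambda>y. avg a' K y * avg a' K y)"
     "integrable M (\<lambda>y. avg a N y * avg a' K y)"
    using abs_avg_le assms by (auto intro!: integrable_bounded_mult)
  moreover have "L2_dist_sq a N a' K = (LINT y|M. avg a N y * avg a N y
      + avg a' K y * avg a' K y - 2 * (avg a N y * avg a' K y))"
    unfolding L2_dist_sq_def by (simp add: power2_eq_square algebra_simps)
  ultimately show ?thesis
    by simp
qed

text \<open>\<open>L\<close> is the limit both of the squared \<open>L\<^sup>2\<close> norms of the averages and of their inner products
  with the (not yet constructed) limit function, whose inner product with \<open>g m\<close> is \<open>l m\<close>.\<close>

definition S_limit :: "(nat \<Rightarrow> real) \<Rightarrow> (nat \<Rightarrow> nat \<Rightarrow> real) \<Rightarrow> real \<Rightarrow> bool" where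
  "S_limit l a L \<longleftrightarrow> averaging_weights a
    \<and> (\<forall>m\<ge>1. (\<lambda>N. \<Sum>n=1..N. a N n * correlation n m) \<longlonglongrightarrow> l m)
    \<and> (\<lambda>N. LINT y|M. avg a N y * avg a N y) \<longlonglongrightarrow> L
    \<and> (\<lambda>K. \<Sum>m=1..K. a K m * l m) \<longlonglongrightarrow> L"

lemma S_limit_dist:
  assumes a: "S_limit l a L" and a': "S_limit l a' L'"
  obtains e where "\<And>K. (\<lambda>N. L2_dist_sq a N a' K) \<longlonglongrightarrow> e K" "e \<longlonglongrightarrow> L - L'"
proof
  define e where "e = (\<lambda>K. L + (LINT y|M. avg a' K y * avg a' K y) - 2 * (\<Sum>m=1..K. a' K m * l m))"
  have w: "averaging_weights a" "averaging_weights a'"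
    using assms by (auto simp: S_limit_def)
  show "(\<lambda>N. L2_dist_sq a N a' K) \<longlonglongrightarrow> e K" for K
    unfolding L2_dist_sq_expand[OF w] e_def integral_avg_mult_avg[OF w(2), of a _ K]
    using a by (intro tendsto_intros) (auto simp: S_limit_def)
  \<comment> \<open>Along \<open>a'\<close> the squared norms and the averages of \<open>l\<close>
    have the same limit \<open>L'\<close>; this is where the equality of the two limits in
    (S)-convergence enters.\<close>
  have "e \<longlonglongrightarrow> L + L' - 2 * L'"
    unfolding e_def using a' by (intro tendsto_intros) (auto simp: S_limit_def)
  then show "e \<longlonglongrightarrow> L - L'"
    by simp
qed

text \<open>Squared distances are nonnegative, hence so is their iterated limit
  \<open>L - L'\<close>. Exchanging the roles of \<open>a\<close> and \<open>a'\<close> gives the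
  reverse inequality.\<close>

lemma S_limit_le:
  assumes "S_limit l a L" "S_limit l a' L'"
  shows "L' \<le> L"
proof -
  obtain e where e: "\<And>K. (\<lambda>N. L2_dist_sq a N a' K) \<longlonglongrightarrow> e K" "e \<longlonglongrightarrow> L - L'"
    using S_limit_dist[OF assms] by blast
  have "0 \<le> e K" for K
    by (rule LIMSEQ_le_const[OF e(1)]) (auto simp: L2_dist_sq_def)
  then have "0 \<le> L - L'"
    by (intro LIMSEQ_le_const[OF e(2)]) auto
  then show ?thesis
    by simp
qed

lemma S_limit_unique: "S_limit l a L \<Longrightarrow> S_limit l a' L' \<Longrightarrow> L = L'"
  by (intro antisym S_limit_le)

text \<open>Since \<open>L = L'\<close>, the iterated limit of the squared L2 distances is 0. The
  square root with the total mass is the form in which they dominate L1 distances.\<close>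

lemma S_limit_dist_L1:
  assumes a: "S_limit l a L" and a': "S_limit l a' L'"
  obtains \<delta> where "\<And>K. (\<lambda>N. sqrt (measure M (space M) * L2_dist_sq a N a' K)) \<longlonglongrightarrow> \<delta> K" "\<delta> \<longlonglongrightarrow> 0"
proof -
  obtain e where e: "\<And>K. (\<lambda>N. L2_dist_sq a N a' K) \<longlonglongrightarrow> e K" "e \<longlonglongrightarrow> L - L'"
    using S_limit_dist[OF assms] by blast
  show thesis
  proof
    show "(\<lambda>N. sqrt (measure M (space M) * L2_dist_sq a N a' K))
        \<longlonglongrightarrow> sqrt (measure M (space M) * e K)" for K
      by (intro tendsto_intros e)
    have "(\<lambda>K. sqrt (measure M (space M) * e K)) \<longlonglongrightarrow> sqrt (measure M (space M) * (L - L'))"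
      by (intro tendsto_intros e)
    then show "(\<lambda>K. sqrt (measure M (space M) * e K)) \<longlonglongrightarrow> 0"
      using S_limit_unique[OF assms] by simp
  qed
qed

lemma integrable_abs_diff_avg:
  "averaging_weights a \<Longrightarrow> integrable M f \<Longrightarrow> integrable M (\<lambda>y. \<bar>avg a N y - f y\<bar>)"
  by (intro integrable_abs Bochner_Integration.integrable_diff integrable_avg)

lemma integral_abs_diff_avg_triangle:
  assumes "averaging_weights a" "averaging_weights a'" "integrable M f"
  shows "(LINT y|M. \<bar>avg a' K y - f y\<bar>)
    \<le> (LINT y|M. \<bar>avg a N y - avg a' K y\<bar>) + (LINT y|M. \<bar>avg a N y - f y\<bar>)"
proof -
  have "(LINT y|M. \<bar>avg a' K y - f y\<bar>) \<le> (LINT y|M. \<bar>avg a N y - avg a' K y\<bar> + \<bar>avg a N y - f y\<bar>)"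
    using assms by (intro integral_mono Bochner_Integration.integrable_add integrable_abs_diff_avg
      integrable_avg) auto
  then show ?thesis
    using assms by (simp add: integrable_abs_diff_avg integrable_avg)
qed

text \<open>All late averages are close in L1 to one fixed average \<open>avg a K\<close>, hence to
  each other.\<close>

lemma S_limit_converges:
  assumes a: "S_limit l a L"
  obtains f where "integrable M f" "(\<lambda>N. LINT y|M. \<bar>avg a N y - f y\<bar>) \<longlonglongrightarrow> 0"
proof (rule bounded_L1_Cauchy_converges)
  have w: "averaging_weights a"
    using a by (simp add: S_limit_def)
  show "\<bar>avg a N y\<bar> \<le> B" for N y
    by (rule abs_avg_le[OF w])
  obtain \<delta> where \<delta>: "\<And>K. (\<lambda>N. sqrt (measure M (space M) * L2_dist_sq a N a K)) \<longlonglongrightarrow> \<delta> K" "\<delta> \<longlonglongrightarrow> 0"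
    using S_limit_dist_L1[OF a a] by blast
  fix e :: real assume "e > 0"
  then have "\<forall>\<^sub>F K in sequentially. \<delta> K < e / 2"
    by (intro order_tendstoD[OF \<delta>(2)]) auto
  then obtain K where "\<delta> K < e / 2"
    using eventually_happens'[OF sequentially_bot] by blast
  then obtain N where "\<And>i. i \<ge> N \<Longrightarrow> sqrt (measure M (space M) * L2_dist_sq a i a K) < e / 2"
    using order_tendstoD(2)[OF \<delta>(1)] unfolding eventually_sequentially by meson
  then have N: "(LINT y|M. \<bar>avg a i y - avg a K y\<bar>) < e / 2" if "i \<ge> N" for i
    using L1_le_L2_dist[OF w w, of i K] that by fastforce
  have "(LINT y|M. \<bar>avg a i y - avg a j y\<bar>) < e" if "i \<ge> N" "j \<ge> N" for i j
    using integral_abs_diff_avg_triangle[OF w w integrable_avg[OF w, of j], of i K]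
      N[OF that(1)] N[OF that(2)] by (simp add: abs_minus_commute)
  then show "\<exists>N. \<forall>i\<ge>N. \<forall>j\<ge>N. (LINT y|M. \<bar>avg a i y - avg a j y\<bar>) < e"
    by blast
qed (use that in auto)

text \<open>For fixed \<open>K\<close>, \<open>avg a N\<close> is a bridge between
  \<open>avg a' K\<close> and \<open>f\<close>: as \<open>N\<close> grows, its distance to
  \<open>f\<close> vanishes and the bound on its distance to \<open>avg a' K\<close> tends to
  \<open>\<delta> K\<close>. Only then does \<open>K\<close> grow.\<close>

lemma S_limit_converges_common:
  assumes a: "S_limit l a L" and a': "S_limit l a' L'"
    and f: "integrable M f" "(\<lambda>N. LINT y|M. \<bar>avg a N y - f y\<bar>) \<longlonglongrightarrow> 0"
  shows "(\<lambda>K. LINT y|M. \<bar>avg a' K y - f y\<bar>) \<longlonglongrightarrow> 0"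
proof -
  have w: "averaging_weights a" "averaging_weights a'"
    using a a' by (auto simp: S_limit_def)
  obtain \<delta> where \<delta>: "\<And>K. (\<lambda>N. sqrt (measure M (space M) * L2_dist_sq a N a' K)) \<longlonglongrightarrow> \<delta> K" "\<delta> \<longlonglongrightarrow> 0"
    using S_limit_dist_L1[OF a a'] by blast
  have "(LINT y|M. \<bar>avg a' K y - f y\<bar>) \<le> \<delta> K" for K
  proof (rule LIMSEQ_le_const)
    show "(\<lambda>N. sqrt (measure M (space M) * L2_dist_sq a N a' K) + (LINT y|M. \<bar>avg a N y - f y\<bar>)) \<longlonglongrightarrow> \<delta> K"
      using tendsto_add[OF \<delta>(1) f(2)] by simp
    show "\<exists>N. \<forall>n\<ge>N. (LINT y|M. \<bar>avg a' K y - f y\<bar>)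
        \<le> sqrt (measure M (space M) * L2_dist_sq a n a' K) + (LINT y|M. \<bar>avg a n y - f y\<bar>)"
      using add_right_mono[OF L1_le_L2_dist[OF w], THEN order_trans[OF integral_abs_diff_avg_triangle[OF w f(1)]]]
      by blast
  qed
  then show ?thesis
    by (intro tendsto_sandwich[OF _ _ tendsto_const \<delta>(2)]) auto
qed

section \<open>From L1 convergence back to inner products\<close>

lemma L1_limit_imp_S_limit:
  assumes A: "\<And>a. a \<in> A \<Longrightarrow> averaging_weights a" and f: "integrable M f"
    and lim: "\<And>a. a \<in> A \<Longrightarrow> (\<lambda>N. LINT y|M. \<bar>avg a N y - f y\<bar>) \<longlonglongrightarrow> 0"
  shows "\<exists>l L. \<forall>a\<in>A. S_limit l a L"
proof -
  txt \<open>Since the averages are bounded by \<open>B\<close>, truncating \<open>f\<close> at \<open>\<plusminus>B\<close> brings it closer to them.\<close>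
  define f' where "f' y = max (- B) (min B (f y))" for y
  define l where "l m = (LINT y|M. f' y * g m y)" for m
  have [measurable]: "f \<in> borel_measurable M"
    using f by auto
  have [measurable]: "f' \<in> borel_measurable M"
    unfolding f'_def by measurable
  \<comment> \<open>The bound at index 0 serves to give \<open>0 \<le> B\<close>, without which the
    truncation levels would be in the wrong order.\<close>
  have f'_le: "\<bar>f' y\<bar> \<le> B" for y
    using bounded_g[of 0 y] unfolding f'_def by linarith
  \<comment> \<open>Both \<open>l\<close> and the proposed limit, the squared norm of
    \<open>f'\<close>, are built without reference to \<open>a\<close>, so they serve all of
    \<open>A\<close> at once.\<close>
  have "S_limit l a (LINT y|M. f' y * f' y)" if "a \<in> A" for a
  proof -
    note w = A[OF that]
    have f'_lim: "(\<lambda>N. LINT y|M. \<bar>avg a N y - f' y\<bar>) \<longlonglongrightarrow> 0"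
    proof (rule tendsto_sandwich[OF _ _ tendsto_const lim[OF that]])
      have "\<bar>avg a N y - f' y\<bar> \<le> \<bar>avg a N y - f y\<bar>" for N y
        using abs_avg_le[OF w, of N y] unfolding f'_def by linarith
      then have "(LINT y|M. \<bar>avg a N y - f' y\<bar>) \<le> (LINT y|M. \<bar>avg a N y - f y\<bar>)" for N
        using f f'_le w
        by (intro integral_mono integrable_abs_diff_avg) (auto intro: integrable_bounded[where B=B])
      then show "\<forall>\<^sub>F N in sequentially. (LINT y|M. \<bar>avg a N y - f' y\<bar>) \<le> (LINT y|M. \<bar>avg a N y - f y\<bar>)"
        by simp
    qed auto
    have "(\<lambda>N. \<Sum>n=1..N. a N n * correlation n m) \<longlonglongrightarrow> l m" if "m \<ge> 1" for m
      unfolding integral_avg_mult_g[OF that, symmetric] l_def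
      using integral_mult_bounded_tendsto[where h="\<lambda>_. g m", OF _ _ _ abs_avg_le[OF w] bounded_g f'_le f'_lim]
        measurable_g[OF that] by (simp add: LIM_zero_iff)
    moreover have "(\<Sum>m=1..K. a K m * l m) = (LINT y|M. avg a K y * f' y)" for K
      using f'_le by (subst integral_avg_mult) (auto simp: l_def mult.commute)
    moreover have sq: "(\<lambda>K. LINT y|M. avg a K y * f' y) \<longlonglongrightarrow> (LINT y|M. f' y * f' y)"
      using integral_mult_bounded_tendsto[where h="\<lambda>_. f'", OF _ _ _ abs_avg_le[OF w] f'_le f'_le f'_lim]
      by (simp add: LIM_zero_iff)
    \<comment> \<open>One factor at a time is replaced by \<open>f'\<close>: the first against the
      varying factor \<open>avg a N\<close>, the second by \<open>sq\<close>.\<close>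
    moreover have "(\<lambda>N. (LINT y|M. avg a N y * avg a N y)) \<longlonglongrightarrow> (LINT y|M. f' y * f' y)"
      using tendsto_add[OF integral_mult_bounded_tendsto[where h="avg a", OF _ _ _ abs_avg_le[OF w]
          abs_avg_le[OF w] f'_le f'_lim] sq]
      by (simp add: mult.commute)
    ultimately show ?thesis
      using w by (simp add: S_limit_def)
  qed
  then show ?thesis
    by blast
qed

text \<open>A set of weights treats both notions together: a singleton gives weak and the weights
  from all \<open>w\<close> in \<open>W\<close> give strong (S)-convergence. A limit function common
  to \<open>A\<close> corresponds to limits \<open>l\<close> common to \<open>A\<close>.\<close>

theorem L1_limit_iff:
  assumes A: "\<And>a. a \<in> A \<Longrightarrow> averaging_weights a"
  shows "(\<exists>f. integrable M f \<and> (\<forall>a\<in>A. (\<lambda>N. LINT y|M. \<bar>avg a N y - f y\<bar>) \<longlonglongrightarrow> 0)) \<longleftrightarrow>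
    (\<forall>m\<ge>1. \<exists>l. \<forall>a\<in>A. (\<lambda>N. \<Sum>n=1..N. a N n * correlation n m) \<longlonglongrightarrow> l) \<and>
    (\<forall>a\<in>A.
      convergent (\<lambda>N. \<Sum>n=1..N. \<Sum>m=1..N. a N n * a N m * correlation n m) \<and>
      convergent (\<lambda>K. \<Sum>m=1..K. a K m * lim (\<lambda>N. \<Sum>n=1..N. a N n * correlation n m)) \<and>
      lim (\<lambda>N. \<Sum>n=1..N. \<Sum>m=1..N. a N n * a N m * correlation n m) =
      lim (\<lambda>K. \<Sum>m=1..K. a K m * lim (\<lambda>N. \<Sum>n=1..N. a N n * correlation n m)))"
    (is "?L1 \<longleftrightarrow> ?corr \<and> ?sq")
proof -
  \<comment> \<open>The outer sums start at \<open>m = 1\<close>, so the limits for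
    \<open>m \<ge> 1\<close> determine every \<open>lim\<close> that occurs.\<close>
  have lim_corr: "(\<lambda>K. \<Sum>m=1..K. a K m * lim (\<lambda>N. \<Sum>n=1..N. a N n * correlation n m))
      = (\<lambda>K. \<Sum>m=1..K. a K m * l m)"
    if "\<forall>m\<ge>1. (\<lambda>N. \<Sum>n=1..N. a N n * correlation n m) \<longlonglongrightarrow> l m" for a l
    using that by (intro ext sum.cong) (auto intro: limI)
  show ?thesis
  proof
    assume ?L1
    then obtain f where f: "integrable M f"
        "\<And>a. a \<in> A \<Longrightarrow> (\<lambda>N. LINT y|M. \<bar>avg a N y - f y\<bar>) \<longlonglongrightarrow> 0"
      by blast
    obtain l L where S: "\<And>a. a \<in> A \<Longrightarrow> S_limit l a L"
      using L1_limit_imp_S_limit[OF A f] by blast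
    have ?corr
      using S unfolding S_limit_def by blast
    moreover have ?sq
    proof
      fix a assume "a \<in> A"
      note w = A[OF this] and S = S[OF this, unfolded S_limit_def]
      note eq = lim_corr[of a l]
      have "(\<lambda>N. \<Sum>n=1..N. \<Sum>m=1..N. a N n * a N m * correlation n m) \<longlonglongrightarrow> L"
        using S by (simp add: integral_avg_square[OF w])
      moreover have "(\<lambda>K. \<Sum>m=1..K. a K m * lim (\<lambda>N. \<Sum>n=1..N. a N n * correlation n m)) \<longlonglongrightarrow> L"
        using S eq by simp
      ultimately show "convergent (\<lambda>N. \<Sum>n=1..N. \<Sum>m=1..N. a N n * a N m * correlation n m) \<and>
        convergent (\<lambda>K. \<Sum>m=1..K. a K m * lim (\<lambda>N. \<Sum>n=1..N. a N n * correlation n m)) \<and>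
        lim (\<lambda>N. \<Sum>n=1..N. \<Sum>m=1..N. a N n * a N m * correlation n m) =
        lim (\<lambda>K. \<Sum>m=1..K. a K m * lim (\<lambda>N. \<Sum>n=1..N. a N n * correlation n m))"
        by (simp add: convergentI limI)
    qed
    ultimately show "?corr \<and> ?sq" ..
  next
    assume R: "?corr \<and> ?sq"
    have "\<exists>l. \<forall>m. m \<ge> 1 \<longrightarrow> (\<forall>a\<in>A. (\<lambda>N. \<Sum>n=1..N. a N n * correlation n m) \<longlonglongrightarrow> l m)"
      using R[THEN conjunct1] by (intro choice) blast
    then obtain l where l: "\<And>a. a \<in> A \<Longrightarrow> \<forall>m\<ge>1. (\<lambda>N. \<Sum>n=1..N. a N n * correlation n m) \<longlonglongrightarrow> l m"
      by blast
    have S: "\<exists>L. S_limit l a L" if "a \<in> A" for a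
    proof
      let ?L = "lim (\<lambda>N. \<Sum>n=1..N. \<Sum>m=1..N. a N n * a N m * correlation n m)"
      note eq = lim_corr[of a l, OF l[OF that]]
        and sq = R[THEN conjunct2, THEN bspec, OF that, unfolded convergent_LIMSEQ_iff]
      have "(\<lambda>N. \<Sum>n=1..N. \<Sum>m=1..N. a N n * a N m * correlation n m) \<longlonglongrightarrow> ?L"
        by (rule sq[THEN conjunct1])
      moreover have "(\<lambda>K. \<Sum>m=1..K. a K m * l m) \<longlonglongrightarrow> ?L"
        unfolding sq[THEN conjunct2, THEN conjunct2] eq by (rule sq[THEN conjunct2, THEN conjunct1, unfolded eq])
      ultimately show "S_limit l a ?L"
        using A[OF that] l[OF that] by (simp add: S_limit_def integral_avg_square)
    qed
    show ?L1
    proof (cases "A = {}")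
      case True
      then show ?thesis
        by (intro exI[of _ "\<lambda>_. 0"]) simp
    next
      case False
      \<comment> \<open>One choice of weights supplies the limit function; sharing \<open>l\<close>
        forces all the others to converge to it as well.\<close>
      then obtain a L where a: "a \<in> A" "S_limit l a L"
        using S by blast
      obtain f where "integrable M f" "(\<lambda>N. LINT y|M. \<bar>avg a N y - f y\<bar>) \<longlonglongrightarrow> 0"
        using S_limit_converges[OF a(2)] by blast
      then show ?thesis
        using S S_limit_converges_common[OF a(2)] by blast
    qed
  qed
qed

end

section \<open>Test functions and the two kinds of weights\<close>

lemma Cc_measurable: "b \<in> Cc \<Longrightarrow> b \<in> borel_measurable borel"
  unfolding Cc_def by (auto intro: borel_measurable_continuous_onI)

lemma Cc_bounded:
  assumes "b \<in> Cc"
  obtains B where "\<And>x. \<bar>b x\<bar> \<le> B"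
proof -
  have "continuous_on UNIV b" and K: "compact (closure {x. b x \<noteq> 0})"
    using assms by (auto simp: Cc_def)
  then have "compact (b ` closure {x. b x \<noteq> 0})"
    by (meson compact_continuous_image continuous_on_subset subset_UNIV)
  then have "bounded (b ` closure {x. b x \<noteq> 0})"
    by (rule compact_imp_bounded)
  then obtain B where "\<forall>x\<in>closure {x. b x \<noteq> 0}. \<bar>b x\<bar> \<le> B"
    by (auto simp: bounded_iff)
  moreover have "x \<in> closure {x. b x \<noteq> 0}" if "b x \<noteq> 0" for x
    by (rule subsetD[OF closure_subset]) (simp add: that)
  \<comment> \<open>If \<open>b\<close> vanishes identically, its support is empty and
    \<open>B\<close> may be negative, hence the maximum with 0.\<close>
  ultimately have "\<bar>b x\<bar> \<le> max 0 B" for x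
    by (cases "b x = 0") (auto simp: le_max_iff_disj)
  then show thesis
    by (rule that)
qed

lemma averaging_weights_uniform: "averaging_weights (\<lambda>N n. 1 / real N)"
  by (simp add: averaging_weights_def)

lemma averaging_weights_wsum:
  assumes "w \<in> W"
  shows "averaging_weights (\<lambda>N n. w (real n / real N) / wsum w N)"
proof -
  have "0 \<le> w (real n / real N)" if "n \<in> {1..N}" for n N
    using assms that by (auto simp: W_def)
  then have "0 \<le> wsum w N" "\<And>n. n \<in> {1..N} \<Longrightarrow> 0 \<le> w (real n / real N)" for N
    by (auto simp: wsum_def intro!: sum_nonneg)
  \<comment> \<open>The quotient is 1, or 0 by the convention for division when
    \<open>wsum w N = 0\<close>; it is at most 1 in both cases.\<close>
  moreover have "(\<Sum>n=1..N. w (real n / real N) / wsum w N) = wsum w N / wsum w N" for N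
    unfolding wsum_def by (rule sum_divide_distrib[symmetric])
  ultimately show ?thesis
    unfolding averaging_weights_def by (simp add: divide_le_eq_1)
qed

section \<open>Application to the compositions of test functions with \<open>U n\<close>\<close>

theorem theorem2p4:
  fixes Q :: "(real ^ 'm) set" and U :: "nat \<Rightarrow> real ^ 'm \<Rightarrow> real ^ 'd"
  assumes "Q \<in> sets lebesgue" and "emeasure lebesgue Q < \<infinity>"
    and "\<And>n. n \<ge> 1 \<Longrightarrow> U n \<in> borel_measurable (lebesgue_on Q)"
  shows "(weakly_S_convergent Q U \<longleftrightarrow>
           (\<forall>b\<in>Cc. \<exists>bU. tendsto_L1 Q (\<lambda>N y. 1 / real N * (\<Sum>n=1..N. b (U n y))) bU)) \<and>
         (strongly_S_convergent Q U \<longleftrightarrow>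
           (\<forall>b\<in>Cc. \<exists>bU. \<forall>w\<in>W.
              tendsto_L1 Q (\<lambda>N y. 1 / wsum w N * (\<Sum>n=1..N. w (real n / real N) * b (U n y))) bU))"
proof -
  have "Q \<in> lmeasurable"
    using assms(1,2) by (simp add: fmeasurable_def)
  then interpret finite_measure "lebesgue_on Q"
    by (rule finite_measure_lebesgue_on)
  have "bounded_sequence (lebesgue_on Q) (\<lambda>n y. b (U n y)) B" if "b \<in> Cc" "\<And>x. \<bar>b x\<bar> \<le> B" for b B
    using that assms(3) Cc_measurable[OF that(1)] by unfold_locales auto
  then have loc: "\<exists>B. bounded_sequence (lebesgue_on Q) (\<lambda>n y. b (U n y)) B" if "b \<in> Cc" for b
    using Cc_bounded that by metis
  have weak: "(\<exists>bU. tendsto_L1 Q (\<lambda>N y. 1 / real N * (\<Sum>n=1..N. b (U n y))) bU) \<longleftrightarrow>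
     (\<forall>m\<ge>1. convergent (\<lambda>N. 1 / real N * (\<Sum>n=1..N. corr Q b U n m))) \<and>
     convergent (\<lambda>N. 1 / (real N)\<^sup>2 * (\<Sum>n=1..N. \<Sum>m=1..N. corr Q b U n m)) \<and>
     convergent (\<lambda>M. 1 / real M * (\<Sum>m=1..M. lim (\<lambda>N. 1 / real N * (\<Sum>n=1..N. corr Q b U n m)))) \<and>
     lim (\<lambda>N. 1 / (real N)\<^sup>2 * (\<Sum>n=1..N. \<Sum>m=1..N. corr Q b U n m)) =
     lim (\<lambda>M. 1 / real M * (\<Sum>m=1..M. lim (\<lambda>N. 1 / real N * (\<Sum>n=1..N. corr Q b U n m))))"
    if "b \<in> Cc" for b
  proof -
    obtain B where "bounded_sequence (lebesgue_on Q) (\<lambda>n y. b (U n y)) B"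
      using loc[OF \<open>b \<in> Cc\<close>] ..
    then interpret bounded_sequence "lebesgue_on Q" "\<lambda>n y. b (U n y)" B .
    let ?a = "\<lambda>N n. 1 / real N"
    have avg: "(\<lambda>N y. 1 / real N * (\<Sum>n=1..N. b (U n y))) = avg ?a"
      by (intro ext) (simp only: avg_def sum_distrib_left)
    have corr: "correlation = corr Q b U"
      by (intro ext) (simp add: correlation_def corr_def)
    \<comment> \<open>With a single choice of weights, a limit common to all weights is plain
      convergence.\<close>
    have "(\<exists>bU. tendsto_L1 Q (avg ?a) bU) \<longleftrightarrow> (\<exists>f. integrable (lebesgue_on Q) f \<and>
        (\<forall>a\<in>{?a}. (\<lambda>N. LINT y|lebesgue_on Q. \<bar>avg a N y - f y\<bar>) \<longlonglongrightarrow> 0))"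
      by (simp add: tendsto_L1_def integrable_avg averaging_weights_uniform)
    also note L1_limit_iff[of "{?a}"]
    finally show ?thesis
      unfolding avg
      by (simp add: averaging_weights_uniform corr convergent_def sum_distrib_left sum_divide_distrib
          power2_eq_square)
  qed
  have strong: "(\<exists>bU. \<forall>w\<in>W.
        tendsto_L1 Q (\<lambda>N y. 1 / wsum w N * (\<Sum>n=1..N. w (real n / real N) * b (U n y))) bU) \<longleftrightarrow>
     (\<forall>m\<ge>1. \<exists>l. \<forall>w\<in>W.
        (\<lambda>N. 1 / wsum w N * (\<Sum>n=1..N. w (real n / real N) * corr Q b U n m)) \<longlonglongrightarrow> l) \<and>
     (\<forall>w\<in>W.
        convergent (\<lambda>N. 1 / (wsum w N)\<^sup>2 *
          (\<Sum>n=1..N. \<Sum>m=1..N. w (real n / real N) * w (real m / real N) * corr Q b U n m)) \<and>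
        convergent (\<lambda>M. 1 / wsum w M * (\<Sum>m=1..M. w (real m / real M) *
          lim (\<lambda>N. 1 / wsum w N * (\<Sum>n=1..N. w (real n / real N) * corr Q b U n m)))) \<and>
        lim (\<lambda>N. 1 / (wsum w N)\<^sup>2 *
          (\<Sum>n=1..N. \<Sum>m=1..N. w (real n / real N) * w (real m / real N) * corr Q b U n m)) =
        lim (\<lambda>M. 1 / wsum w M * (\<Sum>m=1..M. w (real m / real M) *
          lim (\<lambda>N. 1 / wsum w N * (\<Sum>n=1..N. w (real n / real N) * corr Q b U n m)))))"
    if "b \<in> Cc" for b
  proof -
    obtain B where "bounded_sequence (lebesgue_on Q) (\<lambda>n y. b (U n y)) B"
      using loc[OF \<open>b \<in> Cc\<close>] ..
    then interpret bounded_sequence "lebesgue_on Q" "\<lambda>n y. b (U n y)" B .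
    define a where "a w N n = w (real n / real N) / wsum w N" for w N n
    have a: "averaging_weights (a w)" if "w \<in> W" for w
      using averaging_weights_wsum[OF that] by (simp add: a_def[abs_def])
    have A: "\<And>v. v \<in> a ` W \<Longrightarrow> averaging_weights v"
      using a by auto
    have avg: "(\<lambda>N y. 1 / wsum w N * (\<Sum>n=1..N. w (real n / real N) * b (U n y))) = avg (a w)" for w
      by (intro ext) (simp add: avg_def a_def sum_divide_distrib)
    have corr: "correlation = corr Q b U"
      by (intro ext) (simp add: correlation_def corr_def)
    have "(\<exists>bU. \<forall>w\<in>W. tendsto_L1 Q (avg (a w)) bU) \<longleftrightarrow> (\<exists>f. integrable (lebesgue_on Q) f \<and>
        (\<forall>a\<in>a ` W. (\<lambda>N. LINT y|lebesgue_on Q. \<bar>avg a N y - f y\<bar>) \<longlonglongrightarrow> 0))"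
    \<comment> \<open>Integrability of \<open>bU\<close> is part of \<open>tendsto_L1\<close>, so it
      can be extracted only from some \<open>w\<close> in \<open>W\<close>. The case split makes it
      unnecessary to exhibit one: for empty \<open>W\<close> the zero function is a witness.\<close>
    proof (cases "W = {}")
      case False
      then show ?thesis
        by (auto simp: tendsto_L1_def integrable_avg a)
    qed (auto intro: exI[of _ "\<lambda>_. 0"])
    also note L1_limit_iff[OF A]
    finally show ?thesis
      unfolding avg
      by (simp add: ball_simps a_def corr sum_distrib_left sum_divide_distrib power2_eq_square)
  qed
  show ?thesis
    unfolding weakly_S_convergent_def strongly_S_convergent_def by (simp only: weak strong cong: ball_cong)
qed

end
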